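(* For every $u\in H_0^1(0,1)$ and for every non-zero $k\in L^2(0,1)$ the following inequality holds for every $\varepsilon\ge 0$: $$\left(4-\frac{3(1+\varepsilon)\left(\|k\|_2^2-k_1^2\right)}{(1+\varepsilon)\|k\|_2^2-k_1^2}\right)\pi^2\|u\|_2^2\ \le\ \|u'\|_2^2+\frac{3\pi^2\varepsilon(1+\varepsilon)}{(1+\varepsilon)\|k\|_2^2-k_1^2}\,\langle k,u\rangle^2 ,$$ where $k_1=\sqrt{2}\int_0^1 k(x)\sin(\pi x)\,dx$.
   Context: $\langle u,v\rangle=\int_0^1 u(x)v(x)\,dx$ and $\|\cdot\|_2$ are the inner product and norm of the real space $L^2(0,1)$. $H_0^1(0,1)$ is the space of $u\in H^1(0,1)$ (functions in $L^2(0,1)$ with weak derivative in $L^2(0,1)$) with $u(0)=u(1)=0$; $u'$ is the derivative of $u$.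
   Formalization: The formal theorem assumes that the denominator (1+ε)‖k‖² − k₁² is non-zero; this excludes only ε = 0 with k a scalar multiple of sin(πx), where both fractions in the inequality are 0/0 and undefined. *)

theory Defs
  imports "HOL-Analysis.Analysis"
begin

text \<open>
  Elements of the Lebesgue space over the open unit interval are represented by functions on
  the reals of which only the restriction to that interval matters, up to null sets.
\<close>

abbreviation unit_meas :: "real measure" where
  "unit_meas \<equiv> lebesgue_on {0<..<1}"

definition L2_unit :: "(real \<Rightarrow> real) set" where
  "L2_unit = {u. u \<in> borel_measurable unit_meas \<and> integrable unit_meas (\<lambda>x. (u x)\<^sup>2)}"

definition L2_inner :: "(real \<Rightarrow> real) \<Rightarrow> (real \<Rightarrow> real) \<Rightarrow> real" where
  "L2_inner u v = (LINT x|unit_meas. u x * v x)"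

definition L2_norm :: "(real \<Rightarrow> real) \<Rightarrow> real" where
  "L2_norm u = sqrt (L2_inner u u)"

definition test_functions :: "(real \<Rightarrow> real) set" where
  "test_functions = {\<phi>. (\<forall>n. (deriv ^^ n) \<phi> differentiable_on UNIV) \<and>
     compact (closure {x. \<phi> x \<noteq> 0}) \<and> closure {x. \<phi> x \<noteq> 0} \<subseteq> {0<..<1}}"

text \<open>
  The defining identity of the weak derivative. It is only used for square-integrable functions,
  for which both integrals exist.
\<close>

definition has_weak_deriv :: "(real \<Rightarrow> real) \<Rightarrow> (real \<Rightarrow> real) \<Rightarrow> bool" where
  "has_weak_deriv u g \<longleftrightarrow>
     (\<forall>\<phi>\<in>test_functions. (LINT x|unit_meas. u x * deriv \<phi> x) = - (LINT x|unit_meas. g x * \<phi> x))"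

definition H1_unit :: "(real \<Rightarrow> real) set" where
  "H1_unit = {u \<in> L2_unit. \<exists>g\<in>L2_unit. has_weak_deriv u g}"

text \<open>The boundary values are those of the continuous representative on the closed interval.\<close>

definition H10_unit :: "(real \<Rightarrow> real) set" where
  "H10_unit = {u \<in> H1_unit. \<exists>v. continuous_on {0..1} v \<and> (AE x in unit_meas. v x = u x) \<and>
     v 0 = 0 \<and> v 1 = 0}"

definition sine_coeff1 :: "(real \<Rightarrow> real) \<Rightarrow> real" where
  "sine_coeff1 k = sqrt 2 * (LINT x|unit_meas. k x * sin (pi * x))"

end

theory Submission
  imports Defs "HOL-Real_Asymp.Real_Asymp"
begin

text \<open>
  Let \<open>a\<close> be the first sine coefficient of \<open>u\<close>. Since the second Dirichlet eigenvalue of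
  \<open>- d\<^sup>2/dx\<^sup>2\<close> is \<open>4 \<pi>\<^sup>2\<close>, one has \<open>\<parallel>u'\<parallel>\<^sup>2 \<ge> 4 \<pi>\<^sup>2 \<parallel>u\<parallel>\<^sup>2 - 3 \<pi>\<^sup>2 a\<^sup>2\<close>. Cauchy-Schwarz for the components
  of \<open>k\<close> and \<open>u\<close> orthogonal to the first sine mode, with \<open>s = \<langle>k,u\<rangle> - a k\<^sub>1\<close>, bounds \<open>s\<^sup>2\<close>; the remaining
  inequality for \<open>a\<^sup>2\<close> is then \<open>((1 + \<epsilon>) s + \<epsilon> a k\<^sub>1)\<^sup>2 \<ge> 0\<close>. The eigenvalue bound is proved without
  Fourier series: for smooth functions by completing squares, and for weakly differentiable ones by
  duality.
\<close>

section \<open>Wirtinger inequalities at the second eigenvalue for smooth functions\<close>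

text \<open>
  With \<open>q = \<pi> cot (\<pi> x)\<close> and \<open>p = - (1 / sin (\<pi> x)) \<integral>\<^sub>0\<^sup>x w(t) sin (\<pi> t) dt\<close>, which satisfies
  \<open>p' = - w - q p\<close>, one has the pointwise identity
  \<open>w'\<^sup>2 - 4 \<pi>\<^sup>2 w\<^sup>2 = (w' - q w - 3 \<pi>\<^sup>2 p)\<^sup>2 + 3 \<pi>\<^sup>2 (w + 3 q p)\<^sup>2 + F'\<close>, where
  \<open>F = q w\<^sup>2 + 6 \<pi>\<^sup>2 p w + 9 \<pi>\<^sup>2 q p\<^sup>2\<close>. It comes from the factorization of \<open>- d\<^sup>2/dx\<^sup>2 - \<pi>\<^sup>2\<close>
  through its ground state \<open>sin (\<pi> x)\<close> and of the partner operator through its ground state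
  \<open>sin\<^sup>2 (\<pi> x)\<close>. The orthogonality of \<open>w\<close> to \<open>sin (\<pi> x)\<close> makes \<open>F\<close> vanish at \<open>1\<close>.
  At both end points division by \<open>sin (\<pi> x) = 0\<close> gives \<open>0\<close>, the correct limit of \<open>F\<close>.
\<close>

lemma wirtinger_second_dirichlet:
  fixes w w' :: "real \<Rightarrow> real"
  assumes dw: "\<And>x. x \<in> {0..1} \<Longrightarrow> (w has_real_derivative w' x) (at x within {0..1})"
    and cw': "continuous_on {0..1} w'" and w0: "w 0 = 0" and w1: "w 1 = 0"
    and orth: "integral {0..1} (\<lambda>x. w x * sin (pi * x)) = 0"
  shows "4 * pi\<^sup>2 * integral {0..1} (\<lambda>x. (w x)\<^sup>2) \<le> integral {0..1} (\<lambda>x. (w' x)\<^sup>2)"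
proof -
  have cw: "continuous_on {0..1} w"
    using dw by (meson DERIV_continuous_on)
  define P where "P x = integral {0..x} (\<lambda>t. w t * sin (pi * t))" for x
  have dP: "(P has_real_derivative w x * sin (pi * x)) (at x within {0..1})" if "x \<in> {0..1}" for x
    unfolding P_def by (rule integral_has_real_derivative) (use that in \<open>auto intro!: continuous_intros cw\<close>)
  have P0: "P 0 = 0" and P1: "P 1 = 0"
    using orth by (auto simp: P_def)
  obtain M where M: "\<And>x. x \<in> {0..1} \<Longrightarrow> \<bar>w' x\<bar> \<le> M"
    using compact_imp_bounded[OF compact_continuous_image[OF cw' compact_Icc]]
    unfolding bounded_iff by fastforce
  have wlip: "\<bar>w x - w y\<bar> \<le> M * \<bar>x - y\<bar>" if "x \<in> {0..1}" "y \<in> {0..1}" for x y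
    using field_differentiable_bound[of "{0..1}" w w' M x y] dw M that by auto
  have Mnn: "M \<ge> 0" using M[of 0] by auto
  have sle: "\<bar>w t * sin (pi * t)\<bar> \<le> \<bar>w t\<bar>" for t
    by (simp add: abs_mult mult_left_le)
  \<comment> \<open>The integrand of \<open>P\<close> is at most \<open>M * x\<close> on
    \<open>{0..x}\<close>, hence quadratic decay. This order is what the term of \<open>F\<close>
    with \<open>(P x)\<^sup>2\<close> over the cube of the sine requires. \<open>Pr\<close> is the
    mirror image at 1, where \<open>P\<close> vanishes by orthogonality.\<close>
  have Pl: "\<bar>P x\<bar> \<le> M * x\<^sup>2" if "x \<in> {0..1}" for x
  proof -
    have "\<bar>P x - P 0\<bar> \<le> (M * x) * \<bar>x - 0\<bar>"
    proof (rule field_differentiable_bound[where S = "{0..x}" and f' = "\<lambda>t. w t * sin (pi * t)", unfolded real_norm_def])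
      show "(P has_real_derivative w t * sin (pi * t)) (at t within {0..x})" if "t \<in> {0..x}" for t
        using dP[of t] that \<open>x \<in> {0..1}\<close> by (auto intro: DERIV_subset)
      show "\<bar>w t * sin (pi * t)\<bar> \<le> M * x" if "t \<in> {0..x}" for t
        using sle[of t] wlip[of t 0] that \<open>x \<in> {0..1}\<close> Mnn w0
        by (smt (verit, ccfv_SIG) atLeastAtMost_iff mult_left_mono)
    qed (use that in auto)
    then show ?thesis using P0 that by (simp add: power2_eq_square algebra_simps)
  qed
  have Pr: "\<bar>P x\<bar> \<le> M * (1 - x)\<^sup>2" if "x \<in> {0..1}" for x
  proof -
    have "\<bar>P x - P 1\<bar> \<le> (M * (1 - x)) * \<bar>x - 1\<bar>"
    proof (rule field_differentiable_bound[where S = "{x..1}" and f' = "\<lambda>t. w t * sin (pi * t)", unfolded real_norm_def])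
      show "(P has_real_derivative w t * sin (pi * t)) (at t within {x..1})" if "t \<in> {x..1}" for t
        using dP[of t] that \<open>x \<in> {0..1}\<close> by (auto intro: DERIV_subset)
      show "\<bar>w t * sin (pi * t)\<bar> \<le> M * (1 - x)" if "t \<in> {x..1}" for t
        using sle[of t] wlip[of t 1] that \<open>x \<in> {0..1}\<close> Mnn w1
        by (smt (verit, ccfv_SIG) atLeastAtMost_iff mult_left_mono)
    qed (use that in auto)
    then show ?thesis using P1 that by (simp add: power2_eq_square algebra_simps)
  qed
  define q where "q x = pi * cos (pi * x) / sin (pi * x)" for x
  define p where "p x = - P x / sin (pi * x)" for x
  define F where "F x = q x * (w x)\<^sup>2 + 6 * pi\<^sup>2 * p x * w x + 9 * pi\<^sup>2 * q x * (p x)\<^sup>2" for x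
  define R where "R x = (w' x - q x * w x - 3 * pi\<^sup>2 * p x)\<^sup>2 + 3 * pi\<^sup>2 * (w x + 3 * q x * p x)\<^sup>2" for x
  have Rnn: "R x \<ge> 0" for x by (simp add: R_def)
  have spos: "sin (pi * x) > 0" if "0 < x" "x < 1" for x
    using that by (intro sin_gt_zero) auto
  have dF: "(F has_real_derivative (w' x)\<^sup>2 - 4 * pi\<^sup>2 * (w x)\<^sup>2 - R x) (at x)"
    if x: "0 < x" "x < 1" for x
  proof -
    have at: "at x within {0..1} = at x"
      using x by (intro at_within_interior) auto
    have s: "sin (pi * x) \<noteq> 0" using spos[OF x] by simp
    have dw1: "(w has_real_derivative w' x) (at x)"
      and dP1: "(P has_real_derivative w x * sin (pi * x)) (at x)"
      using dw[of x] dP[of x] x at by auto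
    have dq: "(q has_real_derivative - pi\<^sup>2 - (q x)\<^sup>2) (at x)"
      unfolding q_def by (rule derivative_eq_intros refl s)+
        (use s in \<open>simp add: power2_eq_square field_simps\<close>)
    have dp: "(p has_real_derivative - w x - q x * p x) (at x)"
      unfolding p_def by (rule derivative_eq_intros refl s dP1)+
        (use s in \<open>simp add: q_def power2_eq_square field_simps\<close>)
    \<comment> \<open>With \<open>q' = - pi\<^sup>2 - q\<^sup>2\<close> and
      \<open>p' = - w - q p\<close> inserted, the claim is a polynomial identity in
      \<open>w\<close>, \<open>w'\<close>, \<open>q\<close>, \<open>p\<close>.\<close>
    show ?thesis
      unfolding F_def
      by (rule derivative_eq_intros refl dw1 dq dp)+ (simp add: R_def power2_eq_square algebra_simps)
  qed
  \<comment> \<open>Here \<open>y\<close> is the distance to the nearer end point in question,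
    \<open>x\<close> at 0 and \<open>1 - x\<close> at 1. As the sine is comparable to
    \<open>y\<close> there, the three terms are of order \<open>y\<close>, \<open>y\<^sup>2\<close>
    and \<open>y\<close>.\<close>
  have Fbound: "\<bar>F x\<bar> \<le> pi * M\<^sup>2 * (y\<^sup>2 / sin (pi * x)) + 6 * pi\<^sup>2 * M\<^sup>2 * (y ^ 3 / sin (pi * x))
      + 9 * pi ^ 3 * M\<^sup>2 * (y ^ 4 / sin (pi * x) ^ 3)"
    if x: "0 < x" "x < 1" and y: "y \<ge> 0" "\<bar>w x\<bar> \<le> M * y" "\<bar>P x\<bar> \<le> M * y\<^sup>2" for x y
  proof -
    have s: "sin (pi * x) > 0" using spos[OF x] .
    have w2: "(w x)\<^sup>2 \<le> M\<^sup>2 * y\<^sup>2"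
      using power_mono[OF y(2), of 2] by (simp add: power_mult_distrib)
    have P2: "(P x)\<^sup>2 \<le> M\<^sup>2 * y ^ 4"
      using power_mono[OF y(3), of 2] by (simp add: power_mult_distrib flip: power_mult)
    have Pw: "\<bar>P x\<bar> * \<bar>w x\<bar> \<le> M\<^sup>2 * y ^ 3"
    proof -
      have "\<bar>P x\<bar> * \<bar>w x\<bar> \<le> (M * y\<^sup>2) * (M * y)" using y by (intro mult_mono) auto
      then show ?thesis by (simp add: power2_eq_square power3_eq_cube algebra_simps)
    qed
    have q: "\<bar>q x\<bar> \<le> pi / sin (pi * x)"
      using s by (simp add: q_def abs_mult divide_right_mono mult_left_le)
    have 1: "\<bar>q x\<bar> * (w x)\<^sup>2 \<le> pi / sin (pi * x) * (M\<^sup>2 * y\<^sup>2)"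
      using q w2 s by (intro mult_mono) auto
    have 2: "\<bar>p x\<bar> * \<bar>w x\<bar> \<le> M\<^sup>2 * y ^ 3 / sin (pi * x)"
      using Pw s by (simp add: p_def divide_right_mono)
    have 3: "\<bar>q x\<bar> * (p x)\<^sup>2 \<le> pi / sin (pi * x) * (M\<^sup>2 * y ^ 4 / (sin (pi * x))\<^sup>2)"
      using q P2 s by (intro mult_mono) (auto simp: p_def power_divide divide_right_mono)
    have "\<bar>F x\<bar> \<le> \<bar>q x\<bar> * (w x)\<^sup>2 + 6 * pi\<^sup>2 * (\<bar>p x\<bar> * \<bar>w x\<bar>) + 9 * pi\<^sup>2 * (\<bar>q x\<bar> * (p x)\<^sup>2)"
      unfolding F_def
      by (rule order_trans[OF abs_triangle_ineq] add_mono order_trans[OF abs_triangle_ineq])+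
        (auto simp: abs_mult)
    also have "\<dots> \<le> pi / sin (pi * x) * (M\<^sup>2 * y\<^sup>2) + 6 * pi\<^sup>2 * (M\<^sup>2 * y ^ 3 / sin (pi * x))
        + 9 * pi\<^sup>2 * (pi / sin (pi * x) * (M\<^sup>2 * y ^ 4 / (sin (pi * x))\<^sup>2))"
      by (intro add_mono mult_left_mono 1 2 3) auto
    finally show ?thesis by (simp add: power2_eq_square power3_eq_cube algebra_simps)
  qed
  have F0: "F 0 = 0" and F1: "F 1 = 0"
    by (simp_all add: F_def w0 w1 p_def)
  have "(F \<longlongrightarrow> 0) (at_right 0)"
  proof (rule tendsto_rabs_zero_cancel, rule tendsto_sandwich[OF _ _ tendsto_const])
    show "\<forall>\<^sub>F x in at_right 0. \<bar>F x\<bar> \<le> pi * M\<^sup>2 * (x\<^sup>2 / sin (pi * x)) + 6 * pi\<^sup>2 * M\<^sup>2 * (x ^ 3 / sin (pi * x))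
      + 9 * pi ^ 3 * M\<^sup>2 * (x ^ 4 / sin (pi * x) ^ 3)"
      using eventually_at_right_real[OF zero_less_one]
    proof eventually_elim
      case (elim x)
      then show ?case using Pl[of x] wlip[of x 0] w0 by (intro Fbound) auto
    qed
    have "((\<lambda>x::real. x\<^sup>2 / sin (pi * x)) \<longlongrightarrow> 0) (at_right 0)"
      "((\<lambda>x::real. x ^ 3 / sin (pi * x)) \<longlongrightarrow> 0) (at_right 0)"
      "((\<lambda>x::real. x ^ 4 / sin (pi * x) ^ 3) \<longlongrightarrow> 0) (at_right 0)"
      by real_asymp+
    from this[THEN tendsto_mult_right_zero]
    show "((\<lambda>x. pi * M\<^sup>2 * (x\<^sup>2 / sin (pi * x)) + 6 * pi\<^sup>2 * M\<^sup>2 * (x ^ 3 / sin (pi * x))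
      + 9 * pi ^ 3 * M\<^sup>2 * (x ^ 4 / sin (pi * x) ^ 3)) \<longlongrightarrow> 0) (at_right 0)"
      by (auto intro!: tendsto_add_zero)
  qed auto
  moreover have "(F \<longlongrightarrow> 0) (at_left 1)"
  proof (rule tendsto_rabs_zero_cancel, rule tendsto_sandwich[OF _ _ tendsto_const])
    show "\<forall>\<^sub>F x in at_left 1. \<bar>F x\<bar> \<le> pi * M\<^sup>2 * ((1 - x)\<^sup>2 / sin (pi * x)) + 6 * pi\<^sup>2 * M\<^sup>2 * ((1 - x) ^ 3 / sin (pi * x))
      + 9 * pi ^ 3 * M\<^sup>2 * ((1 - x) ^ 4 / sin (pi * x) ^ 3)"
      using eventually_at_left_real[OF zero_less_one]
    proof eventually_elim
      case (elim x)
      then show ?case using Pr[of x] wlip[of x 1] w1 by (intro Fbound) auto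
    qed
    have "((\<lambda>x::real. (1 - x)\<^sup>2 / sin (pi * x)) \<longlongrightarrow> 0) (at_left 1)"
      "((\<lambda>x::real. (1 - x) ^ 3 / sin (pi * x)) \<longlongrightarrow> 0) (at_left 1)"
      "((\<lambda>x::real. (1 - x) ^ 4 / sin (pi * x) ^ 3) \<longlongrightarrow> 0) (at_left 1)"
      by real_asymp+
    from this[THEN tendsto_mult_right_zero]
    show "((\<lambda>x. pi * M\<^sup>2 * ((1 - x)\<^sup>2 / sin (pi * x)) + 6 * pi\<^sup>2 * M\<^sup>2 * ((1 - x) ^ 3 / sin (pi * x))
      + 9 * pi ^ 3 * M\<^sup>2 * ((1 - x) ^ 4 / sin (pi * x) ^ 3)) \<longlongrightarrow> 0) (at_left 1)"
      by (auto intro!: tendsto_add_zero)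
  qed auto
  ultimately have contF: "continuous_on {0..1} F"
    using dF F0 F1
    by (intro continuous_on_IccI) (auto intro!: DERIV_isCont dest: simp: isCont_def[symmetric])
  have "((\<lambda>x. (w' x)\<^sup>2 - 4 * pi\<^sup>2 * (w x)\<^sup>2 - R x) has_integral F 1 - F 0) {0..1}"
    using dF by (intro fundamental_theorem_of_calculus_interior contF)
      (auto simp: has_real_derivative_iff_has_vector_derivative)
  moreover have "((\<lambda>x. (w' x)\<^sup>2 - 4 * pi\<^sup>2 * (w x)\<^sup>2) has_integral
      integral {0..1} (\<lambda>x. (w' x)\<^sup>2) - 4 * pi\<^sup>2 * integral {0..1} (\<lambda>x. (w x)\<^sup>2)) {0..1}"
    by (intro has_integral_diff has_integral_mult_right integrable_integral integrable_continuous_real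
        continuous_intros cw cw')
  ultimately have "F 1 - F 0 \<le> integral {0..1} (\<lambda>x. (w' x)\<^sup>2) - 4 * pi\<^sup>2 * integral {0..1} (\<lambda>x. (w x)\<^sup>2)"
    by (rule has_integral_le) (use Rnn in auto)
  then show ?thesis by (simp add: F0 F1)
qed

text \<open>
  By duality: \<open>\<integral> f\<^sup>2 = - \<integral> Y f'\<close> for the primitive \<open>Y\<close> of \<open>f\<close>, to which the Dirichlet version applies.
\<close>

lemma wirtinger_second_neumann:
  fixes f f' :: "real \<Rightarrow> real"
  assumes df: "\<And>x. x \<in> {0..1} \<Longrightarrow> (f has_real_derivative f' x) (at x within {0..1})"
    and cf': "continuous_on {0..1} f'"
    and mean: "integral {0..1} f = 0"
    and orth: "integral {0..1} (\<lambda>x. f x * cos (pi * x)) = 0"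
  shows "4 * pi\<^sup>2 * integral {0..1} (\<lambda>x. (f x)\<^sup>2) \<le> integral {0..1} (\<lambda>x. (f' x)\<^sup>2)"
proof -
  have cf: "continuous_on {0..1} f"
    using df by (meson DERIV_continuous_on)
  define Y where "Y x = integral {0..x} f" for x
  have dY: "(Y has_real_derivative f x) (at x within {0..1})" if "x \<in> {0..1}" for x
    unfolding Y_def by (rule integral_has_real_derivative) (use that in \<open>auto intro!: continuous_intros cf\<close>)
  have cY: "continuous_on {0..1} Y"
    using dY by (meson DERIV_continuous_on)
  have Y0: "Y 0 = 0" and Y1: "Y 1 = 0"
    using mean by (auto simp: Y_def)
  \<comment> \<open>Integrating the derivative of \<open>Y x * cos (pi * x)\<close> turns the cosine
    condition on \<open>f\<close> into the sine condition on \<open>Y\<close>.\<close>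
  have "((\<lambda>x. f x * cos (pi * x) - Y x * (pi * sin (pi * x))) has_integral Y 1 * cos (pi * 1) - Y 0 * cos (pi * 0)) {0..1}"
    by (rule fundamental_theorem_of_calculus)
      (auto intro!: derivative_eq_intros dY simp flip: has_real_derivative_iff_has_vector_derivative)
  moreover have "((\<lambda>x. f x * cos (pi * x) - pi * (Y x * sin (pi * x))) has_integral
      integral {0..1} (\<lambda>x. f x * cos (pi * x)) - pi * integral {0..1} (\<lambda>x. Y x * sin (pi * x))) {0..1}"
    by (intro has_integral_diff has_integral_mult_right integrable_integral integrable_continuous_real
        continuous_intros cf cY)
  ultimately have Yorth: "integral {0..1} (\<lambda>x. Y x * sin (pi * x)) = 0"
    using orth Y0 Y1 by (auto simp: mult_ac dest: has_integral_unique)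
  have *: "4 * pi\<^sup>2 * integral {0..1} (\<lambda>x. (Y x)\<^sup>2) \<le> integral {0..1} (\<lambda>x. (f x)\<^sup>2)"
    by (rule wirtinger_second_dirichlet[OF dY cf Y0 Y1 Yorth])
  have "((\<lambda>x. f x * f x + Y x * f' x) has_integral Y 1 * f 1 - Y 0 * f 0) {0..1}"
    by (rule fundamental_theorem_of_calculus)
      (auto intro!: derivative_eq_intros dY df simp flip: has_real_derivative_iff_has_vector_derivative)
  moreover have "((\<lambda>x. (f x)\<^sup>2 + Y x * f' x) has_integral
      integral {0..1} (\<lambda>x. (f x)\<^sup>2) + integral {0..1} (\<lambda>x. Y x * f' x)) {0..1}"
    by (intro has_integral_add integrable_integral integrable_continuous_real
        continuous_intros cf cY cf')
  ultimately have Yf: "integral {0..1} (\<lambda>x. Y x * f' x) = - integral {0..1} (\<lambda>x. (f x)\<^sup>2)"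
    using Y0 Y1 by (auto simp: power2_eq_square dest: has_integral_unique)
  \<comment> \<open>This is the integral of \<open>(f' + 4 * pi\<^sup>2 * Y)\<^sup>2\<close>. The
    factor makes the square vanish in the extremal case \<open>Y x = sin (2 * pi * x)\<close>, so
    that nothing is lost.\<close>
  have "((\<lambda>x. (f' x)\<^sup>2 + 8 * pi\<^sup>2 * (Y x * f' x) + 16 * pi ^ 4 * (Y x)\<^sup>2) has_integral
      integral {0..1} (\<lambda>x. (f' x)\<^sup>2) + 8 * pi\<^sup>2 * integral {0..1} (\<lambda>x. Y x * f' x)
      + 16 * pi ^ 4 * integral {0..1} (\<lambda>x. (Y x)\<^sup>2)) {0..1}"
    by (intro has_integral_add has_integral_mult_right integrable_integral integrable_continuous_real
        continuous_intros cf cY cf')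
  moreover have "(f' x)\<^sup>2 + 8 * pi\<^sup>2 * (Y x * f' x) + 16 * pi ^ 4 * (Y x)\<^sup>2 = (f' x + 4 * pi\<^sup>2 * Y x)\<^sup>2" for x
    by (simp add: power2_eq_square power4_eq_xxxx algebra_simps)
  ultimately have "0 \<le> integral {0..1} (\<lambda>x. (f' x)\<^sup>2) + 8 * pi\<^sup>2 * integral {0..1} (\<lambda>x. Y x * f' x)
      + 16 * pi ^ 4 * integral {0..1} (\<lambda>x. (Y x)\<^sup>2)"
    by (auto intro: has_integral_nonneg)
  also have "\<dots> \<le> integral {0..1} (\<lambda>x. (f' x)\<^sup>2) - 8 * pi\<^sup>2 * integral {0..1} (\<lambda>x. (f x)\<^sup>2)
      + 4 * pi\<^sup>2 * integral {0..1} (\<lambda>x. (f x)\<^sup>2)"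
    using mult_left_mono[OF *, of "4 * pi\<^sup>2"] Yf by (simp add: power2_eq_square power4_eq_xxxx algebra_simps)
  finally show ?thesis by simp
qed

section \<open>The inner product on square-integrable functions\<close>

lemma L2_mult_integrable:
  assumes "u \<in> L2_unit" "v \<in> L2_unit"
  shows "integrable unit_meas (\<lambda>x. u x * v x)"
proof (rule Bochner_Integration.integrable_bound)
  show "integrable unit_meas (\<lambda>x. (u x)\<^sup>2 + (v x)\<^sup>2)"
    using assms by (auto simp: L2_unit_def)
  show "(\<lambda>x. u x * v x) \<in> borel_measurable unit_meas"
    using assms by (auto simp: L2_unit_def)
  have "\<bar>a * b\<bar> \<le> a\<^sup>2 + b\<^sup>2" for a b :: real
  proof -
    have "2 * \<bar>a\<bar> * \<bar>b\<bar> \<le> a\<^sup>2 + b\<^sup>2" using sum_squares_bound[of "\<bar>a\<bar>" "\<bar>b\<bar>"] by simp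
    moreover have "0 \<le> \<bar>a\<bar> * \<bar>b\<bar>" by simp
    ultimately show ?thesis unfolding abs_mult by linarith
  qed
  then show "AE x in unit_meas. norm (u x * v x) \<le> norm ((u x)\<^sup>2 + (v x)\<^sup>2)"
    by simp
qed

lemma L2_unit_diff_scale:
  assumes "u \<in> L2_unit" "v \<in> L2_unit"
  shows "(\<lambda>x. u x - c * v x) \<in> L2_unit"
proof -
  have "integrable unit_meas (\<lambda>x. u x * u x - 2 * c * (u x * v x) + c\<^sup>2 * (v x * v x))"
    using assms by (intro Bochner_Integration.integrable_add Bochner_Integration.integrable_diff
        integrable_mult_right L2_mult_integrable)
  then show ?thesis
    using assms by (auto simp: L2_unit_def power2_eq_square algebra_simps)
qed

lemma L2_inner_commute: "L2_inner u v = L2_inner v u"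
  by (simp add: L2_inner_def mult.commute)

lemma L2_inner_diff_scale_left:
  assumes "u \<in> L2_unit" "v \<in> L2_unit" "w \<in> L2_unit"
  shows "L2_inner (\<lambda>x. u x - c * v x) w = L2_inner u w - c * L2_inner v w"
proof -
  have "(\<lambda>x. (u x - c * v x) * w x) = (\<lambda>x. u x * w x - c * (v x * w x))"
    by (simp add: algebra_simps)
  then show ?thesis
    using assms by (simp add: L2_inner_def L2_mult_integrable)
qed

lemma L2_inner_diff_scale_right:
  assumes "u \<in> L2_unit" "v \<in> L2_unit" "w \<in> L2_unit"
  shows "L2_inner w (\<lambda>x. u x - c * v x) = L2_inner w u - c * L2_inner w v"
  using L2_inner_diff_scale_left[OF assms] by (simp add: L2_inner_commute)

lemma L2_inner_self_nonneg: "L2_inner u u \<ge> 0"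
  by (simp add: L2_inner_def)

lemma L2_norm_power2: "(L2_norm u)\<^sup>2 = L2_inner u u"
  by (simp add: L2_norm_def L2_inner_self_nonneg)

text \<open>The squared norm of \<open>u - t v\<close> is a nonnegative quadratic in
  \<open>t\<close>, evaluated at its minimum \<open>t = B / C\<close>. Elements are functions and
  not classes, so \<open>C = 0\<close> is possible for nonzero \<open>v\<close> and is treated
  apart.\<close>

lemma L2_Cauchy_Schwarz:
  assumes "u \<in> L2_unit" "v \<in> L2_unit"
  shows "(L2_inner u v)\<^sup>2 \<le> L2_inner u u * L2_inner v v"
proof -
  define A B C where "A = L2_inner u u" and "B = L2_inner u v" and "C = L2_inner v v"
  have *: "0 \<le> A - 2 * t * B + t\<^sup>2 * C" for t
  proof -
    have mem: "(\<lambda>x. u x - t * v x) \<in> L2_unit" using assms by (rule L2_unit_diff_scale)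
    have "L2_inner (\<lambda>x. u x - t * v x) (\<lambda>x. u x - t * v x) = (A - t * B) - t * (B - t * C)"
      unfolding L2_inner_diff_scale_left[OF assms mem] L2_inner_diff_scale_right[OF assms assms(1)]
        L2_inner_diff_scale_right[OF assms assms(2)] A_def B_def C_def L2_inner_commute[of v u] ..
    then show ?thesis
      using L2_inner_self_nonneg[of "\<lambda>x. u x - t * v x"] by (simp add: power2_eq_square algebra_simps)
  qed
  have "C \<ge> 0" by (simp add: C_def L2_inner_self_nonneg)
  show ?thesis
  proof (cases "C = 0")
    case True
    have "B = 0"
    proof (rule ccontr)
      assume "B \<noteq> 0"
      \<comment> \<open>For \<open>C = 0\<close> the quadratic is affine in \<open>t\<close>; this
        \<open>t\<close> gives it the value -1.\<close>
      then have "2 * ((A + 1) / (2 * B)) * B = A + 1" by simp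
      then show False using *[of "(A + 1) / (2 * B)"] True by simp
    qed
    then show ?thesis using True unfolding A_def[symmetric] B_def[symmetric] C_def[symmetric] by simp
  next
    case False
    have "0 \<le> C * (A - 2 * (B / C) * B + (B / C)\<^sup>2 * C)"
      using *[of "B / C"] \<open>C \<ge> 0\<close> by (rule mult_nonneg_nonneg[rotated])
    also have "\<dots> = A * C - B\<^sup>2"
      using False by (simp add: field_simps power2_eq_square)
    finally show ?thesis unfolding A_def[symmetric] B_def[symmetric] C_def[symmetric] by simp
  qed
qed

lemma unit_meas_finite: "finite_measure unit_meas"
  by (rule finite_measure_lebesgue_on) (metis box_real(1) lmeasurable_box)

lemma L2_unit_integrable:
  assumes "u \<in> L2_unit"
  shows "integrable unit_meas u"
proof -
  interpret finite_measure unit_meas by (rule unit_meas_finite)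
  have "(\<lambda>x. 1) \<in> L2_unit" by (simp add: L2_unit_def)
  from L2_mult_integrable[OF assms this] show ?thesis by simp
qed

text \<open>The bridge between the Lebesgue integrals of the theorem and the gauge integrals for
  which the fundamental theorem of calculus and the Wirtinger inequalities are stated.\<close>

lemma unit_integral_continuous:
  fixes f :: "real \<Rightarrow> real"
  assumes "continuous_on {0..1} f"
  shows "integrable unit_meas f" and "(LINT x|unit_meas. f x) = integral {0..1} f"
proof -
  have "set_integrable lebesgue {0<..<1} f"
    by (rule set_integrable_subset[OF absolutely_integrable_continuous_real[OF assms]]) auto
  then show int: "integrable unit_meas f"
    by (simp add: integrable_restrict_space set_integrable_def)
  then show "(LINT x|unit_meas. f x) = integral {0..1} f"
    by (subst lebesgue_integral_eq_integral) (auto simp: integral_open_interval_real)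
qed

lemma L2_unit_continuous:
  assumes "continuous_on {0..1} f"
  shows "f \<in> L2_unit"
  using unit_integral_continuous(1)[of f] unit_integral_continuous(1)[of "\<lambda>x. (f x)\<^sup>2"] assms
  by (auto simp: L2_unit_def intro!: continuous_intros)

lemma L2_inner_continuous:
  assumes "continuous_on {0..1} f" "continuous_on {0..1} g"
  shows "L2_inner f g = integral {0..1} (\<lambda>x. f x * g x)"
  unfolding L2_inner_def by (intro unit_integral_continuous(2) continuous_intros assms)

lemma L2_inner_cong_AE:
  assumes "AE x in unit_meas. u x = v x" "u \<in> L2_unit" "v \<in> L2_unit" "w \<in> L2_unit"
  shows "L2_inner u w = L2_inner v w"
  unfolding L2_inner_def using assms by (intro integral_cong_AE) (auto simp: L2_unit_def)

section \<open>The algebraic reduction\<close>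

text \<open>Here \<open>K\<close>, \<open>U\<close>, \<open>N\<close> stand for the squared norms of
  the kernel, of \<open>u\<close> and of its derivative, \<open>J\<close> for the inner product of
  kernel and \<open>u\<close>, and \<open>k\<close>, \<open>a\<close> for their first sine
  coefficients. Only an upper bound for \<open>a\<^sup>2\<close> is missing, since
  \<open>spec\<close> is linear in it.\<close>

lemma rank_one_perturbation_inequality:
  fixes a K U N J k \<epsilon> :: real
  assumes spec: "4 * pi\<^sup>2 * U - 3 * pi\<^sup>2 * a\<^sup>2 \<le> N"
    and cs: "(J - a * k)\<^sup>2 \<le> (K - k\<^sup>2) * (U - a\<^sup>2)"
    and R: "K - k\<^sup>2 \<ge> 0" and e: "\<epsilon> \<ge> 0" and nz: "(1 + \<epsilon>) * K - k\<^sup>2 \<noteq> 0"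
  shows "(4 - 3 * (1 + \<epsilon>) * (K - k\<^sup>2) / ((1 + \<epsilon>) * K - k\<^sup>2)) * pi\<^sup>2 * U
    \<le> N + 3 * pi\<^sup>2 * \<epsilon> * (1 + \<epsilon>) / ((1 + \<epsilon>) * K - k\<^sup>2) * J\<^sup>2"
proof -
  define D where "D = (1 + \<epsilon>) * K - k\<^sup>2"
  \<comment> \<open>Both summands are nonnegative, so a nonzero denominator is positive and division
    by it keeps the inequality.\<close>
  have "D = (1 + \<epsilon>) * (K - k\<^sup>2) + \<epsilon> * k\<^sup>2" by (simp add: D_def algebra_simps)
  moreover have "0 \<le> (1 + \<epsilon>) * (K - k\<^sup>2)" "0 \<le> \<epsilon> * k\<^sup>2" using R e by auto
  ultimately have "D > 0" using nz unfolding D_def by linarith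
  have "(1 + \<epsilon>) * (J - a * k)\<^sup>2 \<le> (1 + \<epsilon>) * ((K - k\<^sup>2) * (U - a\<^sup>2))"
    using cs e by (intro mult_left_mono) auto
  \<comment> \<open>Once \<open>cs\<close> is inserted, this square is exactly the difference of the
    two sides of the next inequality.\<close>
  moreover have "0 \<le> ((1 + \<epsilon>) * (J - a * k) + \<epsilon> * (a * k))\<^sup>2" by simp
  ultimately have "a\<^sup>2 * D \<le> (1 + \<epsilon>) * (K - k\<^sup>2) * U + \<epsilon> * (1 + \<epsilon>) * J\<^sup>2"
    by (simp add: D_def power2_eq_square algebra_simps)
  then have "a\<^sup>2 \<le> ((1 + \<epsilon>) * (K - k\<^sup>2) * U + \<epsilon> * (1 + \<epsilon>) * J\<^sup>2) / D"
    using \<open>D > 0\<close> by (simp add: field_simps)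
  then have "3 * pi\<^sup>2 * a\<^sup>2 \<le> 3 * pi\<^sup>2 * (((1 + \<epsilon>) * (K - k\<^sup>2) * U + \<epsilon> * (1 + \<epsilon>) * J\<^sup>2) / D)"
    by (intro mult_left_mono) auto
  also have "\<dots> = 3 * (1 + \<epsilon>) * (K - k\<^sup>2) / D * pi\<^sup>2 * U + 3 * pi\<^sup>2 * \<epsilon> * (1 + \<epsilon>) / D * J\<^sup>2"
    using \<open>D > 0\<close> by (simp add: field_simps)
  finally show ?thesis
    using spec unfolding D_def[symmetric] by (simp add: algebra_simps)
qed

section \<open>A smooth bump on the unit interval\<close>

text \<open>The polynomial and the exponent are parameters because the family is then closed under
  differentiation, which gives smoothness of the bump without a formula for its higher
  derivatives.\<close>

definition bump_term :: "real poly \<Rightarrow> nat \<Rightarrow> real \<Rightarrow> real" where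
  "bump_term P m x =
     (if 0 < x \<and> x < 1 then poly P x / (x * (1 - x)) ^ m * exp (- 1 / (x * (1 - x))) else 0)"

lemma bump_term_bound:
  obtains C where "\<And>x. 0 < x \<Longrightarrow> x < 1 \<Longrightarrow> \<bar>bump_term P m x\<bar> \<le> C * (x * (1 - x))\<^sup>2"
proof -
  obtain B where B: "\<And>x. x \<in> {0..1} \<Longrightarrow> \<bar>poly P x\<bar> \<le> B"
    using compact_imp_bounded[OF compact_continuous_image[OF _ compact_Icc[of 0 1]], of "poly P"]
    unfolding bounded_iff by (fastforce intro: continuous_intros)
  have "\<bar>bump_term P m x\<bar> \<le> B * real (m + 2) ^ (m + 2) * (x * (1 - x))\<^sup>2" if x: "0 < x" "x < 1" for x
  proof -
    define y where "y = x * (1 - x)"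
    have y: "y > 0" using x by (simp add: y_def)
    \<comment> \<open>The exponential beats every power through
      \<open>exp z \<ge> (1 + z / n) ^ n\<close>. With \<open>n = m + 2\<close>, \<open>m\<close>
      powers of \<open>y\<close> cancel the denominator and two remain.\<close>
    have "(1 / y / real (m + 2)) ^ (m + 2) \<le> (1 + 1 / y / real (m + 2)) ^ (m + 2)"
      using y by (intro power_mono) auto
    also have "\<dots> \<le> exp (1 / y)"
      using y by (intro exp_ge_one_plus_x_over_n_power_n) (auto intro: order_trans[of _ 0])
    finally have "inverse (exp (1 / y)) \<le> inverse ((1 / (y * real (m + 2))) ^ (m + 2))"
      using y by (intro le_imp_inverse_le) (auto simp del: power_Suc power_add)
    then have "exp (- 1 / y) \<le> (y * real (m + 2)) ^ (m + 2)"
      by (simp add: exp_minus power_one_over inverse_eq_divide del: power_Suc power_add)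
    then have "\<bar>poly P x\<bar> / y ^ m * exp (- 1 / y) \<le> B / y ^ m * (y * real (m + 2)) ^ (m + 2)"
      using B[of x] x y by (intro mult_mono divide_right_mono) auto
    also have "\<dots> = B * real (m + 2) ^ (m + 2) * y\<^sup>2"
      using y by (simp only: power_add power_mult_distrib) (simp add: field_simps)
    finally show ?thesis
      using x y by (simp add: bump_term_def abs_mult flip: y_def)
  qed
  then show ?thesis by (rule that)
qed

text \<open>With \<open>z = x * (1 - x)\<close>, encoded as \<open>[:0, 1, -1:]\<close>, and
  \<open>z' = 1 - 2 * x\<close>, encoded as \<open>[:1, -2:]\<close>, the derivative inside the
  interval is \<open>(P' z\<^sup>2 - m P z' z + P z') / z ^ (m + 2) * exp (- 1 / z)\<close>. At 0
  and 1 the quadratic bound makes the difference quotient tend to 0.\<close>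

lemma bump_term_has_derivative:
  "(bump_term P m has_real_derivative
     bump_term (pderiv P * [:0, 1, -1:]\<^sup>2 - smult (real m) (P * [:1, -2:] * [:0, 1, -1:]) + P * [:1, -2:])
       (m + 2) x) (at x)" (is "(_ has_real_derivative ?D x) _")
proof -
  obtain C where C: "\<And>x. 0 < x \<Longrightarrow> x < 1 \<Longrightarrow> \<bar>bump_term P m x\<bar> \<le> C * (x * (1 - x))\<^sup>2"
    using bump_term_bound[of P m] by blast
  have outer: "(bump_term P m has_real_derivative 0) (at x)"
    if z: "x \<in> {0, 1}" for x
  proof -
    have bd: "\<bar>bump_term P m y\<bar> \<le> \<bar>C\<bar> * (y - x)\<^sup>2" for y
    proof (cases "0 < y \<and> y < 1")
      case True
      have "(y * (1 - y))\<^sup>2 \<le> (y - x)\<^sup>2"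
      proof (rule abs_le_square_iff[THEN iffD1])
        show "\<bar>y * (1 - y)\<bar> \<le> \<bar>y - x\<bar>"
          using z True by (auto simp: abs_mult mult_left_le mult_left_le_one_le)
      qed
      then have "C * (y * (1 - y))\<^sup>2 \<le> \<bar>C\<bar> * (y - x)\<^sup>2"
        by (meson abs_ge_self abs_ge_zero mult_mono zero_le_power2)
      then show ?thesis using C[of y] True by linarith
    qed (auto simp: bump_term_def)
    have "bump_term P m x = 0" using z by (auto simp: bump_term_def)
    moreover have "((\<lambda>y. bump_term P m y / (y - x)) \<longlongrightarrow> 0) (at x)"
    proof (rule Lim_null_comparison)
      show "\<forall>\<^sub>F y in at x. norm (bump_term P m y / (y - x)) \<le> \<bar>C\<bar> * \<bar>y - x\<bar>"
        unfolding eventually_at_filter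
      proof (intro always_eventually allI impI)
        fix y assume "y \<noteq> x"
        then show "norm (bump_term P m y / (y - x)) \<le> \<bar>C\<bar> * \<bar>y - x\<bar>"
          using bd[of y] by (simp add: field_simps power2_eq_square abs_mult_self_eq)
      qed
      show "((\<lambda>y. \<bar>C\<bar> * \<bar>y - x\<bar>) \<longlongrightarrow> 0) (at x)"
        by (auto intro!: tendsto_eq_intros)
    qed
    ultimately show ?thesis by (simp add: has_field_derivative_iff)
  qed
  consider "x < 0 \<or> 1 < x" | "x \<in> {0, 1}" | "0 < x \<and> x < 1" by force
  then show ?thesis
  proof cases
    case 1
    have "((\<lambda>x. 0) has_real_derivative 0) (at x)" by simp
    then have "(bump_term P m has_real_derivative 0) (at x)"
      by (rule has_field_derivative_transform_within_open[where S = "- {0..1}"])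
        (use 1 in \<open>auto simp: bump_term_def\<close>)
    then show ?thesis using 1 by (auto simp: bump_term_def)
  next
    case 2
    then show ?thesis using outer[OF 2] by (auto simp: bump_term_def)
  next
    case 3
    then have nz: "x * (1 - x) \<noteq> 0" "x * (1 - x) > 0" by auto
    define i where "i x = inverse (x * (1 - x))" for x :: real
    have bt: "bump_term Q n y = poly Q y * i y ^ n * exp (- i y)" if "0 < y" "y < 1" for Q n y
      using that by (simp add: bump_term_def i_def divide_inverse power_inverse del: inverse_mult_distrib)
    have di: "(i has_real_derivative - (1 - 2 * x) * (i x)\<^sup>2) (at x)"
      unfolding i_def by (rule derivative_eq_intros refl nz)+ (simp add: power2_eq_square algebra_simps)
    have i: "x * (1 - x) * i x = 1" unfolding i_def by (rule right_inverse) (rule nz)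
    \<comment> \<open>For \<open>m = 0\<close> the truncated exponent is harmless, since the factor
      \<open>real m\<close> vanishes.\<close>
    have pow: "real m * i x ^ (m - Suc 0) * (i x)\<^sup>2 = real m * (i x ^ m * i x)"
      by (cases m) (auto simp: power2_eq_square)
    have "((\<lambda>x. poly P x * i x ^ m * exp (- i x)) has_real_derivative
        (poly (pderiv P) x * i x ^ m - (1 - 2 * x) * poly P x * (real m * i x ^ (m - Suc 0) * (i x)\<^sup>2)
          + poly P x * i x ^ m * (1 - 2 * x) * (i x)\<^sup>2) * exp (- i x)) (at x)"
      by (rule derivative_eq_intros refl di)+ (simp add: algebra_simps)
    also have "poly (pderiv P) x * i x ^ m - (1 - 2 * x) * poly P x * (real m * i x ^ (m - Suc 0) * (i x)\<^sup>2)
          + poly P x * i x ^ m * (1 - 2 * x) * (i x)\<^sup>2 =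
        (poly (pderiv P) x * (x * (1 - x) * i x)\<^sup>2 - real m * poly P x * (1 - 2 * x) * (x * (1 - x) * i x) * i x
          + poly P x * (1 - 2 * x) * (i x)\<^sup>2) * i x ^ m"
      unfolding pow i by (simp add: algebra_simps)
    also have "\<dots> = (poly (pderiv P) x * (x * (1 - x))\<^sup>2 - real m * (poly P x * (1 - 2 * x) * (x * (1 - x)))
          + poly P x * (1 - 2 * x)) * i x ^ (m + 2)"
      unfolding power_mult_distrib power_add by (simp add: power2_eq_square algebra_simps)
    also have "poly (pderiv P) x * (x * (1 - x))\<^sup>2 - real m * (poly P x * (1 - 2 * x) * (x * (1 - x)))
          + poly P x * (1 - 2 * x) = poly (pderiv P * [:0, 1, -1:]\<^sup>2
          - smult (real m) (P * [:1, -2:] * [:0, 1, -1:]) + P * [:1, -2:]) x"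
      by (simp add: algebra_simps)
    also have "\<dots> * i x ^ (m + 2) * exp (- i x) = ?D x"
      by (rule bt[symmetric]) (use 3 in auto)
    finally show ?thesis
    proof (rule has_field_derivative_transform_within_open)
      show "x \<in> {0<..<1}" using 3 by simp
      show "poly P y * i y ^ m * exp (- i y) = bump_term P m y" if "y \<in> {0<..<1}" for y
        using that bt by simp
    qed auto
  qed
qed

section \<open>Smoothed indicators as test functions\<close>

abbreviation bump :: "real \<Rightarrow> real" where
  "bump \<equiv> bump_term 1 0"

text \<open>
  The test functions are differences of two shifted and rescaled copies of a primitive \<open>S\<close> of the
  bump. They are smoothed indicators of an interval, and as the width \<open>d\<close> shrinks the defining
  identity of the weak derivative tends to the fundamental theorem of calculus. No mollification of
  general functions is needed.
\<close>

lemma iterated_deriv_differentiable: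
  assumes "f \<in> F" and "\<And>f. f \<in> F \<Longrightarrow> f differentiable_on UNIV \<and> deriv f \<in> F"
  shows "(deriv ^^ n) f differentiable_on UNIV"
proof -
  have "(deriv ^^ n) f \<in> F" by (induction n) (use assms in auto)
  then show ?thesis using assms(2) by blast
qed

lemma bump_antiderivative:
  obtains S :: "real \<Rightarrow> real" where "\<And>x. (S has_real_derivative bump x) (at x)"
proof -
  have "isCont bump x" for x
    using bump_term_has_derivative by (rule DERIV_isCont)
  then show ?thesis
    using einterval_antiderivative[of "-\<infinity>" \<infinity> bump] that
    by (auto simp: has_real_derivative_iff_has_vector_derivative)
qed

lemma bump_nonneg: "bump x \<ge> 0"
  and bump_pos: "0 < x \<Longrightarrow> x < 1 \<Longrightarrow> bump x > 0"
  and bump_eq_0: "x \<le> 0 \<or> 1 \<le> x \<Longrightarrow> bump x = 0"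
  by (auto simp: bump_term_def)

lemma affine_chain:
  assumes "\<And>x::real. (f has_real_derivative f' x) (at x)"
  shows "((\<lambda>x. f ((x - a) / d)) has_real_derivative f' ((x - a) / d) / d) (at x)"
proof -
  have "((\<lambda>x. (x - a) / d) has_real_derivative 1 / d) (at x)"
    \<comment> \<open>For \<open>d = 0\<close> the quotient is constantly 0, and
      \<open>1 / 0 = 0\<close> is its derivative.\<close>
    by (cases "d = 0") (auto intro!: derivative_eq_intros)
  from DERIV_chain2[OF assms this] show ?thesis by simp
qed

lemma bump_kernel_continuous: "continuous_on T (\<lambda>x. bump ((x - a) / d) / d)"
proof (rule continuous_at_imp_continuous_on, rule ballI)
  fix x
  show "isCont (\<lambda>x. bump ((x - a) / d) / d) x"
    by (rule DERIV_isCont[OF DERIV_cdivide[OF affine_chain[OF bump_term_has_derivative]]])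
qed

context
  fixes S :: "real \<Rightarrow> real"
  assumes S: "\<And>x. (S has_real_derivative bump x) (at x)"
begin

lemma step_mono: "x \<le> y \<Longrightarrow> S x \<le> S y"
  using S bump_nonneg by (meson DERIV_nonneg_imp_nondecreasing)

lemma step_less: "S 0 < S 1"
  using MVT2[of 0 1 S bump] S bump_pos by fastforce

lemma step_left: "x \<le> 0 \<Longrightarrow> S x = S 0"
proof -
  assume "x \<le> 0"
  have "S 0 - S x = 0" if "x < 0"
  proof -
    obtain z where "z < 0" "S 0 - S x = (0 - x) * bump z"
      using MVT2[OF \<open>x < 0\<close> S] by blast
    then show ?thesis using bump_eq_0[of z] by simp
  qed
  with \<open>x \<le> 0\<close> show ?thesis by fastforce
qed

lemma step_right: "x \<ge> 1 \<Longrightarrow> S x = S 1"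
proof -
  assume "x \<ge> 1"
  have "S x - S 1 = 0" if "x > 1"
  proof -
    obtain z where "z > 1" "S x - S 1 = (x - 1) * bump z"
      using MVT2[OF \<open>1 < x\<close> S] by blast
    then show ?thesis using bump_eq_0[of z] by simp
  qed
  with \<open>x \<ge> 1\<close> show ?thesis by fastforce
qed

text \<open>All values of \<open>S\<close> lie between \<open>S 0\<close> and \<open>S 1\<close>.
  This provides the majorant for dominated convergence.\<close>

lemma step_diff_bound: "\<bar>S x - S y\<bar> \<le> S 1 - S 0"
proof -
  have "S 0 \<le> S z" "S z \<le> S 1" for z
    using step_mono[of 0 z] step_left[of z] step_mono[of z 1] step_right[of z] by fastforce+
  from this[of x] this[of y] show ?thesis by linarith
qed

lemma step_diff_deriv:
  "((\<lambda>x. S ((x - a) / d) - S ((x - b) / d)) has_real_derivative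
     bump ((x - a) / d) / d - bump ((x - b) / d) / d) (at x)"
  by (intro DERIV_diff affine_chain S)

lemma step_diff_test_function:
  assumes "d > 0" "a > 0" "b > 0" "a + d < 1" "b + d < 1"
  shows "(\<lambda>x. S ((x - a) / d) - S ((x - b) / d)) \<in> test_functions"
proof -
  let ?\<phi> = "\<lambda>x. S ((x - a) / d) - S ((x - b) / d)"
  \<comment> \<open>A family closed under \<open>deriv\<close>: the factor \<open>c\<close> collects
    the powers of \<open>1 / d\<close>, and \<open>S\<close> is replaced by some
    \<open>bump_term\<close> after the first derivative.\<close>
  define F where "F = {\<lambda>x. c * (f ((x - a) / d) - f ((x - b) / d)) |c f. f = S \<or> (\<exists>P m. f = bump_term P m)}"
  have "(deriv ^^ n) ?\<phi> differentiable_on UNIV" for n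
  proof (rule iterated_deriv_differentiable)
    show "?\<phi> \<in> F" unfolding F_def by (rule CollectI, rule exI[of _ 1], rule exI[of _ S]) auto
    fix g assume "g \<in> F"
    then obtain c f where g: "g = (\<lambda>x. c * (f ((x - a) / d) - f ((x - b) / d)))"
      and f: "f = S \<or> (\<exists>P m. f = bump_term P m)" by (auto simp: F_def)
    obtain Q n where f': "\<And>x. (f has_real_derivative bump_term Q n x) (at x)"
      using f S bump_term_has_derivative by blast
    have g': "(g has_real_derivative c / d * (bump_term Q n ((x - a) / d) - bump_term Q n ((x - b) / d))) (at x)" for x
      
      unfolding g using DERIV_cmult[OF DERIV_diff[OF affine_chain[OF f'] affine_chain[OF f']], of c]
      by (simp add: diff_divide_distrib right_diff_distrib)
    then have "deriv g = (\<lambda>x. c / d * (bump_term Q n ((x - a) / d) - bump_term Q n ((x - b) / d)))"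
      using DERIV_imp_deriv by blast
    then have "deriv g \<in> F" unfolding F_def by blast
    moreover have "g differentiable_on UNIV"
      using g' by (meson differentiable_at_withinI differentiable_on_def real_differentiable_def)
    ultimately show "g differentiable_on UNIV \<and> deriv g \<in> F" by blast
  qed
  moreover have sub: "closure {x. ?\<phi> x \<noteq> 0} \<subseteq> {min a b..max a b + d}"
  proof (rule closure_minimal)
    show "{x. ?\<phi> x \<noteq> 0} \<subseteq> {min a b..max a b + d}"
    proof (rule subsetI, rule ccontr)
      fix x assume x: "x \<in> {x. ?\<phi> x \<noteq> 0}" "x \<notin> {min a b..max a b + d}"
      then consider "x \<le> a" "x \<le> b" | "x \<ge> a + d" "x \<ge> b + d" by force
      then have "?\<phi> x = 0"
      proof cases
        case 1
        then have "(x - a) / d \<le> 0" "(x - b) / d \<le> 0" using assms(1) by (auto simp: field_simps)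
        then show ?thesis using step_left[of "(x - a) / d"] step_left[of "(x - b) / d"] by simp
      next
        case 2
        then have "(x - a) / d \<ge> 1" "(x - b) / d \<ge> 1" using assms(1) by (auto simp: field_simps)
        then show ?thesis using step_right[of "(x - a) / d"] step_right[of "(x - b) / d"] by simp
      qed
      then show False using x by simp
    qed
  qed auto
  moreover have "{min a b..max a b + d} \<subseteq> {0<..<1}" using assms by auto
  moreover have "compact (closure {x. ?\<phi> x \<noteq> 0})"
    using compact_Int_closed[OF compact_Icc closed_closure] sub by (metis Int_absorb1)
  ultimately show ?thesis unfolding test_functions_def by blast
qed

end

text \<open>A mean value theorem for the weight \<open>bump\<close>: the integral is the total mass
  \<open>S 1 - S 0\<close> times a value of \<open>v\<close> on the support of the kernel. Limits
  then need only the continuity of \<open>v\<close>.\<close>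

lemma step_kernel_mean:
  assumes S: "\<And>x. (S has_real_derivative bump x) (at x)"
    and cv: "continuous_on {0..1} v" and d: "d > 0" "a \<ge> 0" "a + d \<le> 1"
  obtains \<xi> where "a \<le> \<xi>" "\<xi> \<le> a + d"
    "(LINT x|unit_meas. v x * (bump ((x - a) / d) / d)) = (S 1 - S 0) * v \<xi>"
proof -
  define b where "b x = bump ((x - a) / d) / d" for x
  have cb: "continuous_on T b" for T
    unfolding b_def by (rule bump_kernel_continuous)
  have cv': "continuous_on {a..a + d} v" using d by (intro continuous_on_subset[OF cv]) auto
  define A where "A x = integral {a..x} (\<lambda>x. v x * b x)" for x
  have dA: "(A has_real_derivative v x * b x) (at x within {a..a + d})" if "x \<in> {a..a + d}" for x
    unfolding A_def
    by (rule integral_has_real_derivative[OF _ that]) (intro continuous_intros cv' cb)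
  define B where "B x = S ((x - a) / d)" for x
  have dB: "(B has_real_derivative b x) (at x)" for x
    unfolding B_def b_def by (rule affine_chain) (rule S)
  have Ba: "B a = S 0" and Bb: "B (a + d) = S 1" using d by (auto simp: B_def)
  have "((\<lambda>x. v x * b x) has_integral A (a + d)) {a..a + d}"
    unfolding A_def by (intro integrable_integral integrable_continuous_real continuous_intros cv' cb)
  then have "((\<lambda>x. v x * b x) has_integral A (a + d)) {0..1}"
  proof (rule has_integral_on_superset)
    fix x assume "x \<notin> {a..a + d}"
    then have "(x - a) / d \<le> 0 \<or> 1 \<le> (x - a) / d" using d by (auto simp: field_simps)
    then show "v x * b x = 0" by (simp add: b_def bump_eq_0)
  qed (use d in auto)
  moreover have "continuous_on {0..1} (\<lambda>x. v x * b x)" by (intro continuous_intros cv cb)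
  ultimately have LA: "(LINT x|unit_meas. v x * b x) = A (a + d)"
    using unit_integral_continuous(2) by (metis integral_unique)
  \<comment> \<open>The auxiliary function of Cauchy's mean value theorem for \<open>A\<close> and
    \<open>B\<close>; it vanishes at both ends. Rolle's point lies strictly inside, where the kernel
    is positive and cancels.\<close>
  define h where "h x = A (a + d) * (B x - S 0) - (S 1 - S 0) * A x" for x
  have dh: "(h has_real_derivative A (a + d) * b x - (S 1 - S 0) * (v x * b x)) (at x within {a..a + d})"
    if "x \<in> {a..a + d}" for x
  proof -
    have "((\<lambda>x. B x - S 0) has_real_derivative b x) (at x within {a..a + d})"
      using DERIV_diff[OF has_field_derivative_at_within[OF dB] DERIV_const] by simp
    then show ?thesis
      unfolding h_def by (intro DERIV_diff DERIV_cmult dA[OF that])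
  qed
  have "\<exists>z. a < z \<and> z < a + d \<and> (*) (A (a + d) * b z - (S 1 - S 0) * (v z * b z)) = (\<lambda>v. 0)"
  proof (rule Rolle_deriv)
    show "h a = h (a + d)" by (simp add: h_def Ba Bb A_def)
    show "continuous_on {a..a + d} h" by (rule DERIV_continuous_on[OF dh])
    fix x assume x: "a < x" "x < a + d"
    then have "at x within {a..a + d} = at x" by (intro at_within_interior) auto
    then show "(h has_derivative (*) (A (a + d) * b x - (S 1 - S 0) * (v x * b x))) (at x)"
      using dh[of x] x by (simp add: has_field_derivative_def)
  qed (use d in auto)
  then obtain z where z: "a < z" "z < a + d"
    and "(*) (A (a + d) * b z - (S 1 - S 0) * (v z * b z)) = (\<lambda>v. 0)" by blast
  from fun_cong[OF this(3), of 1] have "A (a + d) * b z = (S 1 - S 0) * v z * b z" by simp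
  moreover have "b z > 0" unfolding b_def using z d by (intro divide_pos_pos bump_pos) (auto simp: field_simps)
  ultimately have "A (a + d) = (S 1 - S 0) * v z" by simp
  with LA z show ?thesis by (intro that[of z]) (auto simp: b_def)
qed

section \<open>From weak derivatives to integration by parts\<close>

lemma test_function_deriv_continuous:
  assumes "\<phi> \<in> test_functions"
  shows "continuous_on T (deriv \<phi>)"
proof -
  have "(deriv ^^ 1) \<phi> differentiable_on UNIV" using assms unfolding test_functions_def by blast
  then show ?thesis
    by (auto intro: continuous_on_subset[OF differentiable_imp_continuous_on])
qed

lemma has_weak_deriv_cong_AE:
  assumes "has_weak_deriv u g" "AE x in unit_meas. v x = u x"
    "u \<in> borel_measurable unit_meas" "v \<in> borel_measurable unit_meas"
  shows "has_weak_deriv v g"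
  unfolding has_weak_deriv_def
proof
  fix \<phi> assume \<phi>: "\<phi> \<in> test_functions"
  have "deriv \<phi> \<in> borel_measurable unit_meas"
    using test_function_deriv_continuous[OF \<phi>, of "{0..1}"] unit_integral_continuous(1)
    by blast
  then have "(LINT x|unit_meas. v x * deriv \<phi> x) = (LINT x|unit_meas. u x * deriv \<phi> x)"
    using assms by (intro integral_cong_AE) auto
  then show "(LINT x|unit_meas. v x * deriv \<phi> x) = - (LINT x|unit_meas. g x * \<phi> x)"
    using assms(1) \<phi> by (simp add: has_weak_deriv_def)
qed

text \<open>Test functions approximating \<open>c\<close> times the indicator of the interval from 0
  to \<open>x\<close> are inserted: one side of the weak identity converges by mean values of
  \<open>v\<close>, the other by dominated convergence. The cut-off inside the integrand keeps the
  domain fixed, as Fubini's theorem needs later.\<close>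

lemma weak_deriv_primitive:
  assumes cv: "continuous_on {0..1} v" and v0: "v 0 = 0" and g: "integrable unit_meas g"
    and weak: "has_weak_deriv v g" and x: "x \<in> {0..1}"
  shows "v x = (LINT t|unit_meas. (if t < x then g t else 0))"
proof -
  obtain S where S: "\<And>x. (S has_real_derivative bump x) (at x)" using bump_antiderivative by blast
  define c where "c = S 1 - S 0"
  have c: "c > 0" using step_less[OF S] by (simp add: c_def)
  define d :: "nat \<Rightarrow> real" where "d n = 1 / (real n + 4)" for n
  \<comment> \<open>Affine in \<open>x\<close>, from \<open>d n\<close> at 0 to
    \<open>1 - 2 * d n\<close> at 1. Both ramps, of width \<open>d n\<close>, thus stay inside the
    open interval even when \<open>x\<close> is an end point.\<close>
  define b where "b n = x * (1 - 3 * d n) + d n" for n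
  define \<phi> where "\<phi> n t = S ((t - d n) / d n) - S ((t - b n) / d n)" for n t
  have d: "0 < d n" "d n \<le> 1 / 4" for n by (auto simp: d_def field_simps)
  have bl: "d n \<le> b n" for n
    using d[of n] x by (simp add: b_def)
  have bu: "b n \<le> 1 - 2 * d n" for n
  proof -
    have "x * (1 - 3 * d n) \<le> 1 * (1 - 3 * d n)" using d[of n] x by (intro mult_right_mono) auto
    then show ?thesis by (simp add: b_def)
  qed
  have d0: "d \<longlonglongrightarrow> 0" unfolding d_def by real_asymp
  have bx: "b \<longlonglongrightarrow> x" unfolding b_def by (rule tendsto_eq_intros d0 refl)+ simp
  have bdx: "(\<lambda>n. b n + d n) \<longlonglongrightarrow> x" by (rule tendsto_eq_intros bx d0 refl)+ simp
  have test: "\<phi> n \<in> test_functions" for n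
    unfolding \<phi>_def using d[of n] bl[of n] bu[of n] by (intro step_diff_test_function S) linarith+
  have "\<forall>n. \<exists>p. d n \<le> fst p \<and> fst p \<le> d n + d n \<and> b n \<le> snd p \<and> snd p \<le> b n + d n \<and>
      (LINT t|unit_meas. v t * deriv (\<phi> n) t) = c * v (fst p) - c * v (snd p)"
    (is "\<forall>n. \<exists>p. ?P' n p")
  proof
    fix n
    obtain \<xi> where \<xi>: "d n \<le> \<xi>" "\<xi> \<le> d n + d n"
      "(LINT x|unit_meas. v x * (bump ((x - d n) / d n) / d n)) = (S 1 - S 0) * v \<xi>"
      using step_kernel_mean[OF S cv, of "d n" "d n"] d[of n] by auto
    obtain \<eta> where \<eta>: "b n \<le> \<eta>" "\<eta> \<le> b n + d n"
      "(LINT x|unit_meas. v x * (bump ((x - b n) / d n) / d n)) = (S 1 - S 0) * v \<eta>"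
      using step_kernel_mean[OF S cv, of "d n" "b n"] d[of n] bl[of n] bu[of n] by auto
    have cb: "continuous_on {0..1} (\<lambda>x. v x * (bump ((x - e) / d n) / d n))" for e
      by (rule continuous_on_mult[OF cv bump_kernel_continuous])
    have "deriv (\<phi> n) = (\<lambda>t. bump ((t - d n) / d n) / d n - bump ((t - b n) / d n) / d n)"
      unfolding \<phi>_def using step_diff_deriv[OF S] DERIV_imp_deriv by blast
    then have "(LINT t|unit_meas. v t * deriv (\<phi> n) t) = c * v \<xi> - c * v \<eta>"
      using \<xi>(3) \<eta>(3) unit_integral_continuous(1)[OF cb]
      by (simp add: right_diff_distrib c_def)
    with \<xi> \<eta> show "\<exists>p. ?P' n p" by (intro exI[of _ "(\<xi>, \<eta>)"]) simp
  qed
  from choice[OF this] obtain p where p: "\<forall>n. ?P' n (p n)" ..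
  define \<xi> \<eta> where "\<xi> n = fst (p n)" and "\<eta> n = snd (p n)" for n
  have \<xi>: "\<And>n. d n \<le> \<xi> n" "\<And>n. \<xi> n \<le> d n + d n"
    and \<eta>: "\<And>n. b n \<le> \<eta> n" "\<And>n. \<eta> n \<le> b n + d n"
    and eq: "\<And>n. (LINT t|unit_meas. v t * deriv (\<phi> n) t) = c * v (\<xi> n) - c * v (\<eta> n)"
    using p by (simp_all add: \<xi>_def \<eta>_def)
  have dd: "(\<lambda>n. d n + d n) \<longlonglongrightarrow> 0" using tendsto_add[OF d0 d0] by simp
  have \<xi>0: "\<xi> \<longlonglongrightarrow> 0"
    by (rule tendsto_sandwich[OF _ _ d0 dd]) (use \<xi> in auto)
  have \<eta>x: "\<eta> \<longlonglongrightarrow> x"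
    by (rule tendsto_sandwich[OF _ _ bx bdx]) (use \<eta> in auto)
  have \<xi>01: "\<xi> n \<in> {0..1}" and \<eta>01: "\<eta> n \<in> {0..1}" for n
    using \<xi>[of n] \<eta>[of n] d[of n] bl[of n] bu[of n] by auto
  have "(\<lambda>n. v (\<xi> n)) \<longlonglongrightarrow> v 0"
    by (rule continuous_on_tendsto_compose[OF cv \<xi>0]) (use \<xi>01 in auto)
  moreover have "(\<lambda>n. v (\<eta> n)) \<longlonglongrightarrow> v x"
    by (rule continuous_on_tendsto_compose[OF cv \<eta>x]) (use \<eta>01 x in auto)
  ultimately have "(\<lambda>n. c * v (\<xi> n) - c * v (\<eta> n)) \<longlonglongrightarrow> c * v 0 - c * v x"
    by (intro tendsto_intros)
  then have lim1: "(\<lambda>n. LINT t|unit_meas. g t * \<phi> n t) \<longlonglongrightarrow> c * v x"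
    using weak test v0 tendsto_minus by (fastforce simp: has_weak_deriv_def simp flip: eq)
  have c\<phi>: "continuous_on {0..1} (\<phi> n)" for n
    unfolding \<phi>_def using step_diff_deriv[OF S] by (meson DERIV_isCont continuous_at_imp_continuous_on)
  have m\<phi>[measurable]: "\<phi> n \<in> borel_measurable unit_meas" for n
    using unit_integral_continuous(1)[OF c\<phi>] by blast
  have [measurable]: "g \<in> borel_measurable unit_meas" using g by blast
  have [measurable]: "(\<lambda>t. t) \<in> borel_measurable unit_meas"
    using unit_integral_continuous(1)[OF continuous_on_id] by auto
  have "(\<lambda>n. LINT t|unit_meas. g t * \<phi> n t) \<longlonglongrightarrow> (LINT t|unit_meas. c * (if t < x then g t else 0))"
  proof (rule integral_dominated_convergence[where w = "\<lambda>t. c * \<bar>g t\<bar>"])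
    show "integrable unit_meas (\<lambda>t. c * \<bar>g t\<bar>)" using g by simp
    show "AE t in unit_meas. norm (g t * \<phi> n t) \<le> c * \<bar>g t\<bar>" for n
      using step_diff_bound[OF S] by (auto simp: abs_mult \<phi>_def c_def mult.commute[of "\<bar>g _\<bar>"] intro!: mult_right_mono)
    \<comment> \<open>At \<open>t = x\<close> the second ramp may keep an intermediate value for all
      \<open>n\<close>, so this null set is excluded.\<close>
    have "AE t in lebesgue. t \<noteq> x"
      by (rule AE_completion[OF AE_lborel_singleton])
    then have "AE t in unit_meas. t \<noteq> x"
      by (auto simp: AE_restrict_space_iff elim: eventually_mono)
    then show "AE t in unit_meas. (\<lambda>n. g t * \<phi> n t) \<longlonglongrightarrow> c * (if t < x then g t else 0)"
      using AE_space
    proof eventually_elim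
      case (elim t)
      then have t: "t > 0" by simp
      have "\<forall>\<^sub>F n in sequentially. d n + d n < t" using order_tendstoD(2)[OF dd t] .
      then have e1: "\<forall>\<^sub>F n in sequentially. S ((t - d n) / d n) = S 1"
      proof eventually_elim
        case (elim n)
        then show ?case using d[of n] by (intro step_right[OF S]) (simp add: field_simps)
      qed
      have "\<forall>\<^sub>F n in sequentially. S ((t - b n) / d n) = (if t < x then S 0 else S 1)"
      proof (cases "t < x")
        case True
        from order_tendstoD(1)[OF bx True] show ?thesis
        proof eventually_elim
          case (elim n)
          then have "(t - b n) / d n \<le> 0" using d[of n] by (simp add: field_simps)
          from step_left[OF S this] show ?case using True by simp
        qed
      next
        case False
        with elim have "x < t" by simp
        from order_tendstoD(2)[OF bdx this] show ?thesis
        proof eventually_elim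
          case (elim n)
          then have "1 \<le> (t - b n) / d n" using d[of n] by (simp add: field_simps)
          from step_right[OF S this] show ?case using False by simp
        qed
      qed
      with e1 have "\<forall>\<^sub>F n in sequentially. g t * \<phi> n t = c * (if t < x then g t else 0)"
        by eventually_elim (auto simp: \<phi>_def c_def)
      then show ?case by (rule tendsto_eventually)
    qed
  qed measurable
  from LIMSEQ_unique[OF lim1 this] show ?thesis using c by simp
qed

text \<open>Writing \<open>v\<close> as the primitive of \<open>g\<close> and exchanging integrals
  over the triangle \<open>t < x\<close> leaves \<open>g t * (\<Omega> 1 - \<Omega> t)\<close>. The
  constant \<open>\<Omega> 1\<close> drops out because \<open>g\<close> has integral
  \<open>v 1 = 0\<close>. Hence \<open>\<Omega>\<close>, unlike a test function, need not vanish
  near the end points.\<close>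

lemma weak_deriv_by_parts:
  assumes cv: "continuous_on {0..1} v" and v0: "v 0 = 0" and v1: "v 1 = 0"
    and g: "integrable unit_meas g" and weak: "has_weak_deriv v g"
    and d\<Omega>: "\<And>x. x \<in> {0..1} \<Longrightarrow> (\<Omega> has_real_derivative \<omega> x) (at x within {0..1})"
    and c\<omega>: "continuous_on {0..1} \<omega>"
  shows "(LINT x|unit_meas. v x * \<omega> x) = - (LINT x|unit_meas. g x * \<Omega> x)"
proof -
  interpret finite_measure unit_meas by (rule unit_meas_finite)
  interpret P: pair_sigma_finite unit_meas unit_meas
    by (simp add: pair_sigma_finite_def sigma_finite_measure_axioms)
  have [measurable]: "g \<in> borel_measurable unit_meas" using g by blast
  have [measurable]: "\<omega> \<in> borel_measurable unit_meas"
    using unit_integral_continuous(1)[OF c\<omega>] by blast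
  have [measurable]: "(\<lambda>t. t) \<in> borel_measurable unit_meas"
    using unit_integral_continuous(1)[OF continuous_on_id] by auto
  have prim: "v x = (LINT t|unit_meas. (if t < x then g t else 0))" if "x \<in> {0..1}" for x
    using weak_deriv_primitive[OF cv v0 g weak that] .
  define f where "f t x = (if t < x then g t * \<omega> x else 0)" for t x
  have f_eq: "f t x = (if t < x then g t else 0) * \<omega> x" for t x by (simp add: f_def)
  have gx: "integrable unit_meas (\<lambda>x. if t < x then g t * \<omega> x else 0)" for t
    by (rule Bochner_Integration.integrable_bound[where f = "\<lambda>x. g t * \<omega> x"])
      (use unit_integral_continuous(1)[OF c\<omega>] in auto)
  have inner: "(LINT x|unit_meas. f t x) = g t * (\<Omega> 1 - \<Omega> t)" if t: "t \<in> {0<..<1}" for t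
  proof -
    have "(\<omega> has_integral \<Omega> 1 - \<Omega> t) {t..1}"
      using t by (intro fundamental_theorem_of_calculus)
        (auto simp flip: has_real_derivative_iff_has_vector_derivative intro!: DERIV_subset[OF d\<Omega>])
    then have "((\<lambda>x. g t * \<omega> x) has_integral g t * (\<Omega> 1 - \<Omega> t)) {t..1}"
      by (rule has_integral_mult_right)
    then have "((\<lambda>x. if x \<in> {t..1} then g t * \<omega> x else 0) has_integral g t * (\<Omega> 1 - \<Omega> t)) {0..1}"
      by (subst has_integral_restrict) (use t in auto)
    \<comment> \<open>The closed cut-off and the strict one in \<open>f\<close> differ only at
      \<open>x = t\<close>.\<close>
    then have "(f t has_integral g t * (\<Omega> 1 - \<Omega> t)) {0..1}"
      by (rule has_integral_spike_finite[of "{t}", rotated 2]) (auto simp: f_def)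
    moreover have "integrable unit_meas (f t)"
      using gx[of t] by (simp add: f_def[abs_def])
    ultimately show ?thesis
      by (subst lebesgue_integral_eq_integral) (auto simp flip: integral_open_interval_real dest: integral_unique)
  qed
  have "integrable (unit_meas \<Otimes>\<^sub>M unit_meas) (case_prod f)"
  proof (rule P.Fubini_integrable)
    show "case_prod f \<in> borel_measurable (unit_meas \<Otimes>\<^sub>M unit_meas)"
      unfolding f_def by measurable
    show "AE t in unit_meas. integrable unit_meas (\<lambda>x. case_prod f (t, x))"
      using gx by (simp add: f_def)
    show "integrable unit_meas (\<lambda>t. LINT x|unit_meas. norm (case_prod f (t, x)))"
    proof (rule Bochner_Integration.integrable_bound)
      let ?I = "LINT x|unit_meas. \<bar>\<omega> x\<bar>"
      show "integrable unit_meas (\<lambda>t. \<bar>g t\<bar> * ?I)" using g by simp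
      show "(\<lambda>t. LINT x|unit_meas. norm (case_prod f (t, x))) \<in> borel_measurable unit_meas"
        unfolding f_def by measurable
      have "(LINT x|unit_meas. \<bar>f t x\<bar>) \<le> (LINT x|unit_meas. \<bar>g t\<bar> * \<bar>\<omega> x\<bar>)" for t
        using gx[of t] unit_integral_continuous(1)[OF c\<omega>]
        by (intro integral_mono) (auto simp: f_def abs_mult)
      then show "AE t in unit_meas. norm (LINT x|unit_meas. norm (case_prod f (t, x))) \<le> norm (\<bar>g t\<bar> * ?I)"
        by simp
    qed
  qed
  from P.Fubini_integral[OF this]
  have "(LINT x|unit_meas. (LINT t|unit_meas. f t x)) = (LINT t|unit_meas. (LINT x|unit_meas. f t x))" .
  moreover have "(LINT x|unit_meas. (LINT t|unit_meas. f t x)) = (LINT x|unit_meas. v x * \<omega> x)"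
    by (intro Bochner_Integration.integral_cong) (auto simp: f_eq prim)
  moreover have "(LINT t|unit_meas. (LINT x|unit_meas. f t x)) = (LINT t|unit_meas. \<Omega> 1 * g t - g t * \<Omega> t)"
    by (intro Bochner_Integration.integral_cong) (auto simp: inner algebra_simps)
  moreover have "integrable unit_meas (\<lambda>t. g t * \<Omega> t)"
  proof -
    have c\<Omega>: "continuous_on {0..1} \<Omega>" by (rule DERIV_continuous_on[OF d\<Omega>])
    then have [measurable]: "\<Omega> \<in> borel_measurable unit_meas" using unit_integral_continuous(1) by blast
    obtain C where C: "\<And>x. x \<in> {0..1} \<Longrightarrow> \<bar>\<Omega> x\<bar> \<le> C"
      using compact_imp_bounded[OF compact_continuous_image[OF c\<Omega> compact_Icc]]
      unfolding bounded_iff by fastforce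
    have bound: "AE t in unit_meas. norm (g t * \<Omega> t) \<le> norm (C * g t)"
      using AE_space
    proof eventually_elim
      case (elim t)
      then have "\<bar>\<Omega> t\<bar> \<le> \<bar>C\<bar>" using C[of t] by auto
      then show ?case by (simp add: abs_mult mult.commute[of "\<bar>g t\<bar>"] mult_right_mono)
    qed
    show ?thesis
      by (rule Bochner_Integration.integrable_bound[OF integrable_mult_right[OF g] _ bound]) measurable
  qed
  moreover have "(LINT t|unit_meas. g t) = 0"
  proof -
    have "(LINT t|unit_meas. g t) = (LINT t|unit_meas. (if t < 1 then g t else 0))"
      by (intro Bochner_Integration.integral_cong) auto
    also have "\<dots> = v 1" by (rule prim[symmetric]) simp
    finally show ?thesis using v1 by simp
  qed
  ultimately show ?thesis using g by simp
qed

section \<open>The first sine mode and the spectral gap\<close>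

lemma integral_sin_sq: "integral {0..1} (\<lambda>x. (sin (pi * x))\<^sup>2) = 1 / 2"
proof -
  define G where "G x = x / 2 - sin (pi * x) * cos (pi * x) / (2 * pi)" for x
  have "((\<lambda>x. (sin (pi * x))\<^sup>2) has_integral G 1 - G 0) {0..1}"
  proof (rule fundamental_theorem_of_calculus)
    fix x :: real
    have "(G has_real_derivative (sin (pi * x))\<^sup>2) (at x)"
      unfolding G_def
      by (rule derivative_eq_intros refl | simp)+
        (simp add: field_simps power2_eq_square[symmetric] cos_squared_eq)
    then show "(G has_vector_derivative (sin (pi * x))\<^sup>2) (at x within {0..1})"
      by (simp add: has_field_derivative_at_within flip: has_real_derivative_iff_has_vector_derivative)
  qed simp
  then show ?thesis by (simp add: integral_unique G_def)
qed

lemma integral_cos_sq: "integral {0..1} (\<lambda>x. (cos (pi * x))\<^sup>2) = 1 / 2"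
proof -
  have "integral {0..1} (\<lambda>x. (cos (pi * x))\<^sup>2) = integral {0..1} (\<lambda>x. 1 - (sin (pi * x))\<^sup>2)"
    by (simp add: cos_squared_eq)
  also have "\<dots> = 1 / 2"
    by (subst integral_diff) (auto simp: integral_sin_sq intro!: integrable_continuous_real continuous_intros)
  finally show ?thesis .
qed

text \<open>The normalized ground state, so that the sine coefficient is an inner product and
  subtracting the mode is an orthogonal projection.\<close>

definition sine_mode :: "real \<Rightarrow> real" where
  "sine_mode x = sqrt 2 * sin (pi * x)"

lemma sine_mode_L2: "sine_mode \<in> L2_unit"
  unfolding sine_mode_def by (intro L2_unit_continuous continuous_intros)

lemma sine_mode_normalized: "L2_inner sine_mode sine_mode = 1"
proof -
  have "L2_inner sine_mode sine_mode = integral {0..1} (\<lambda>x. 2 * (sin (pi * x))\<^sup>2)"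
    unfolding sine_mode_def
    by (subst L2_inner_continuous) (auto intro!: continuous_intros simp: power2_eq_square algebra_simps)
  then show ?thesis by (simp add: integral_sin_sq)
qed

lemma L2_inner_sine_mode: "L2_inner k sine_mode = sine_coeff1 k"
proof -
  have "L2_inner k sine_mode = (LINT x|unit_meas. sqrt 2 * (k x * sin (pi * x)))"
    by (simp add: L2_inner_def sine_mode_def mult_ac)
  then show ?thesis by (simp add: sine_coeff1_def)
qed

text \<open>
  The Neumann version is applied to the mean-free primitive \<open>\<Omega>\<close> of \<open>w = v - a sqrt 2 sin (\<pi> x)\<close>,
  so that only the linear identity \<open>weak_deriv_by_parts\<close> is needed for the weak derivative, never
  a product rule.
\<close>

lemma spectral_gap_H10:
  assumes u: "u \<in> H10_unit" and g: "g \<in> L2_unit" and weak: "has_weak_deriv u g"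
  shows "4 * pi\<^sup>2 * L2_inner u u - 3 * pi\<^sup>2 * (sine_coeff1 u)\<^sup>2 \<le> L2_inner g g"
proof -
  have uL: "u \<in> L2_unit" using u by (simp add: H10_unit_def H1_unit_def)
  obtain v where cv: "continuous_on {0..1} v" and ae: "AE x in unit_meas. v x = u x"
    and v0: "v 0 = 0" and v1: "v 1 = 0"
    using u unfolding H10_unit_def by blast
  have vL: "v \<in> L2_unit" by (rule L2_unit_continuous[OF cv])
  have weakv: "has_weak_deriv v g"
    using has_weak_deriv_cong_AE[OF weak ae] uL vL by (auto simp: L2_unit_def)
  define a where "a = sine_coeff1 v"
  have va: "L2_inner v sine_mode = a" by (simp add: L2_inner_sine_mode a_def)
  have inner_u: "L2_inner u w = L2_inner v w" if "w \<in> L2_unit" for w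
    using L2_inner_cong_AE[OF ae vL uL that] by simp
  have uu: "L2_inner u u = L2_inner v v"
    using inner_u[OF uL] inner_u[OF vL] by (simp add: L2_inner_commute[of v u])
  have ua: "sine_coeff1 u = a"
    using inner_u[OF sine_mode_L2] va by (simp add: L2_inner_sine_mode)
  have parts: "L2_inner v \<omega> = - L2_inner g \<Omega>"
    if "\<And>x. x \<in> {0..1} \<Longrightarrow> (\<Omega> has_real_derivative \<omega> x) (at x within {0..1})" "continuous_on {0..1} \<omega>" for \<Omega> \<omega>
    unfolding L2_inner_def using weak_deriv_by_parts[OF cv v0 v1 L2_unit_integrable[OF g] weakv that] .
  define e where "e x = sqrt 2 * cos (pi * x)" for x
  have ce: "continuous_on {0..1} e" unfolding e_def by (intro continuous_intros)
  have csm: "continuous_on {0..1} sine_mode" unfolding sine_mode_def by (intro continuous_intros)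
  have eL: "e \<in> L2_unit" by (rule L2_unit_continuous[OF ce])
  have ee: "L2_inner e e = 1"
  proof -
    have "L2_inner e e = integral {0..1} (\<lambda>x. 2 * (cos (pi * x))\<^sup>2)"
      unfolding L2_inner_continuous[OF ce ce] by (simp add: e_def power2_eq_square algebra_simps)
    then show ?thesis by (simp add: integral_cos_sq)
  qed
  have ge: "L2_inner g e = pi * a"
  proof -
    \<comment> \<open>The form \<open>0 - pi * sine_mode x\<close> fits the bilinearity lemmas for
      \<open>u x - c * v x\<close>.\<close>
    have "(e has_real_derivative 0 - pi * sine_mode x) (at x within {0..1})" for x
      unfolding e_def sine_mode_def by (auto intro!: derivative_eq_intros)
    then have "L2_inner v (\<lambda>x. 0 - pi * sine_mode x) = - L2_inner g e"
      by (intro parts continuous_intros csm)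
    moreover have "L2_inner v (\<lambda>x. 0 - pi * sine_mode x) = L2_inner v (\<lambda>x. 0) - pi * a"
      using L2_inner_diff_scale_right[OF _ sine_mode_L2 vL, of "\<lambda>x. 0" pi] va
        L2_unit_continuous[OF continuous_on_const] by simp
    ultimately show ?thesis by (simp add: L2_inner_def)
  qed
  define w where "w x = v x - a * sine_mode x" for x
  have w_fun: "w = (\<lambda>x. v x - a * sine_mode x)" by (rule ext) (simp add: w_def)
  have cw: "continuous_on {0..1} w" unfolding w_def by (intro continuous_intros cv csm)
  have wL: "w \<in> L2_unit" by (rule L2_unit_continuous[OF cw])
  have we: "L2_inner w sine_mode = 0"
    unfolding w_def using L2_inner_diff_scale_left[OF vL sine_mode_L2 sine_mode_L2] va sine_mode_normalized by simp
  have vw: "L2_inner v w = L2_inner v v - a\<^sup>2"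
    unfolding w_def using L2_inner_diff_scale_right[OF vL sine_mode_L2 vL] va by (simp add: power2_eq_square)
  have ww: "L2_inner w w = L2_inner v v - a\<^sup>2"
  proof -
    have "L2_inner w w = L2_inner v w - a * L2_inner sine_mode w"
      using L2_inner_diff_scale_left[OF vL sine_mode_L2 wL, of a, folded w_fun] .
    then show ?thesis using we vw by (simp add: L2_inner_commute[of sine_mode w])
  qed
  have orth: "integral {0..1} (\<lambda>x. w x * sin (pi * x)) = 0"
  proof -
    have "sqrt 2 * integral {0..1} (\<lambda>x. w x * sin (pi * x)) = L2_inner w sine_mode"
      unfolding L2_inner_continuous[OF cw csm] by (simp add: sine_mode_def mult_ac flip: integral_mult_right)
    then show ?thesis using we by simp
  qed
  define I where "I x = integral {0..x} w" for x
  define \<Omega> where "\<Omega> x = I x - integral {0..1} I" for x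
  have dI: "(I has_real_derivative w x) (at x within {0..1})" if "x \<in> {0..1}" for x
    unfolding I_def by (rule integral_has_real_derivative[OF cw that])
  have cI: "continuous_on {0..1} I" by (rule DERIV_continuous_on[OF dI])
  have d\<Omega>: "(\<Omega> has_real_derivative w x) (at x within {0..1})" if "x \<in> {0..1}" for x
    unfolding \<Omega>_def using DERIV_diff[OF dI[OF that] DERIV_const] by simp
  have c\<Omega>: "continuous_on {0..1} \<Omega>" by (rule DERIV_continuous_on[OF d\<Omega>])
  have mean: "integral {0..1} \<Omega> = 0"
    unfolding \<Omega>_def by (subst integral_diff) (auto intro: integrable_continuous_real cI)
  have orth\<Omega>: "integral {0..1} (\<lambda>x. \<Omega> x * cos (pi * x)) = 0"
  proof -
    have "((\<lambda>x. w x * sin (pi * x) + pi * (\<Omega> x * cos (pi * x))) has_integral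
        \<Omega> 1 * sin (pi * 1) - \<Omega> 0 * sin (pi * 0)) {0..1}"
      by (rule fundamental_theorem_of_calculus)
        (auto intro!: derivative_eq_intros d\<Omega> simp flip: has_real_derivative_iff_has_vector_derivative)
    moreover have "((\<lambda>x. w x * sin (pi * x) + pi * (\<Omega> x * cos (pi * x))) has_integral
        integral {0..1} (\<lambda>x. w x * sin (pi * x)) + pi * integral {0..1} (\<lambda>x. \<Omega> x * cos (pi * x))) {0..1}"
      by (intro has_integral_add has_integral_mult_right integrable_integral integrable_continuous_real
          continuous_intros cw c\<Omega>)
    ultimately show ?thesis using orth by (auto dest: has_integral_unique)
  qed
  have \<Omega>L: "\<Omega> \<in> L2_unit" by (rule L2_unit_continuous[OF c\<Omega>])
  have wirt: "4 * pi\<^sup>2 * L2_inner \<Omega> \<Omega> \<le> L2_inner w w"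
    using wirtinger_second_neumann[OF d\<Omega> cw mean orth\<Omega>]
    unfolding L2_inner_continuous[OF c\<Omega> c\<Omega>] L2_inner_continuous[OF cw cw] power2_eq_square by simp
  have eO: "L2_inner e \<Omega> = 0"
  proof -
    have "L2_inner e \<Omega> = sqrt 2 * integral {0..1} (\<lambda>x. \<Omega> x * cos (pi * x))"
      unfolding L2_inner_continuous[OF ce c\<Omega>] by (simp add: e_def mult_ac flip: integral_mult_right)
    then show ?thesis using orth\<Omega> by simp
  qed
  have gO: "L2_inner g \<Omega> = - L2_inner w w"
    using parts[OF d\<Omega> cw] vw ww by simp
  \<comment> \<open>This is \<open>g\<close> without its component along \<open>e\<close>, and the
    candidate for the derivative of \<open>w\<close>; only its inner products are used.\<close>
  define h where "h x = g x - (a * pi) * e x" for x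
  have h_fun: "h = (\<lambda>x. g x - (a * pi) * e x)" by (rule ext) (simp add: h_def)
  have hL: "h \<in> L2_unit" unfolding h_def by (rule L2_unit_diff_scale[OF g eL])
  have hO: "L2_inner h \<Omega> = - L2_inner w w"
    unfolding h_def L2_inner_diff_scale_left[OF g eL \<Omega>L] using eO gO by simp
  have he: "L2_inner h e = 0"
    unfolding h_def L2_inner_diff_scale_left[OF g eL eL] using ge ee by simp
  have hg: "L2_inner h g = L2_inner g g - a\<^sup>2 * pi\<^sup>2"
    unfolding h_def L2_inner_diff_scale_left[OF g eL g] using ge
    by (simp add: L2_inner_commute[of e g] power2_eq_square)
  have hh: "L2_inner h h = L2_inner g g - a\<^sup>2 * pi\<^sup>2"
    using L2_inner_diff_scale_right[OF g eL hL, of "a * pi", folded h_fun] he hg by simp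
  \<comment> \<open>The duality square of the Neumann case again, now
    \<open>h + 4 * pi\<^sup>2 * \<Omega>\<close>, which vanishes when \<open>w\<close> is a multiple
    of \<open>sin (2 * pi * x)\<close>.\<close>
  have "0 \<le> L2_inner (\<lambda>x. h x - (- 4 * pi\<^sup>2) * \<Omega> x) (\<lambda>x. h x - (- 4 * pi\<^sup>2) * \<Omega> x)"
    by (rule L2_inner_self_nonneg)
  also have "\<dots> = L2_inner h h + 8 * pi\<^sup>2 * L2_inner h \<Omega> + 16 * pi ^ 4 * L2_inner \<Omega> \<Omega>"
    unfolding L2_inner_diff_scale_left[OF hL \<Omega>L L2_unit_diff_scale[OF hL \<Omega>L]]
      L2_inner_diff_scale_right[OF hL \<Omega>L hL] L2_inner_diff_scale_right[OF hL \<Omega>L \<Omega>L]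
      L2_inner_commute[of \<Omega> h]
    by (simp add: power2_eq_square power4_eq_xxxx algebra_simps)
  also have "\<dots> \<le> L2_inner h h - 8 * pi\<^sup>2 * L2_inner w w + 4 * pi\<^sup>2 * L2_inner w w"
    using mult_left_mono[OF wirt, of "4 * pi\<^sup>2"] hO by (simp add: power2_eq_square power4_eq_xxxx algebra_simps)
  \<comment> \<open>The bound \<open>4 * pi\<^sup>2\<close> holds off the first mode, which itself
    contributes \<open>pi\<^sup>2 * a\<^sup>2\<close>; the difference is the
    \<open>3 * pi\<^sup>2\<close>.\<close>
  finally show ?thesis
    unfolding uu ua using hh ww by (simp add: algebra_simps)
qed

section \<open>Conclusion by projecting off the first mode\<close>

theorem proposition4p1:
  fixes u u' k :: "real \<Rightarrow> real" and \<epsilon> :: real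
  assumes "u \<in> H10_unit"
    and "u' \<in> L2_unit" and "has_weak_deriv u u'"
    and "k \<in> L2_unit" and "\<not> (AE x in unit_meas. k x = 0)"
    and "\<epsilon> \<ge> 0"
    and "(1 + \<epsilon>) * (L2_norm k)\<^sup>2 - (sine_coeff1 k)\<^sup>2 \<noteq> 0"
  shows "(4 - 3 * (1 + \<epsilon>) * ((L2_norm k)\<^sup>2 - (sine_coeff1 k)\<^sup>2)
              / ((1 + \<epsilon>) * (L2_norm k)\<^sup>2 - (sine_coeff1 k)\<^sup>2)) * pi\<^sup>2 * (L2_norm u)\<^sup>2
         \<le> (L2_norm u')\<^sup>2
           + 3 * pi\<^sup>2 * \<epsilon> * (1 + \<epsilon>) / ((1 + \<epsilon>) * (L2_norm k)\<^sup>2 - (sine_coeff1 k)\<^sup>2)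
             * (L2_inner k u)\<^sup>2"
proof -
  have uL: "u \<in> L2_unit" using assms(1) by (simp add: H10_unit_def H1_unit_def)
  \<comment> \<open>Projecting off \<open>sine_mode\<close> subtracts the product of the
    coefficients from every inner product. The instances for \<open>k\<close> and \<open>u\<close>
    turn Cauchy-Schwarz into the hypothesis \<open>cs\<close> of the algebraic lemma.\<close>
  have residual: "(\<lambda>x. f x - sine_coeff1 f * sine_mode x) \<in> L2_unit"
    "L2_inner (\<lambda>x. f x - sine_coeff1 f * sine_mode x) (\<lambda>x. h x - sine_coeff1 h * sine_mode x)
      = L2_inner f h - sine_coeff1 f * sine_coeff1 h" if fh: "f \<in> L2_unit" "h \<in> L2_unit" for f h
  proof -
    show "(\<lambda>x. f x - sine_coeff1 f * sine_mode x) \<in> L2_unit"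
      by (rule L2_unit_diff_scale[OF fh(1) sine_mode_L2])
    show "L2_inner (\<lambda>x. f x - sine_coeff1 f * sine_mode x) (\<lambda>x. h x - sine_coeff1 h * sine_mode x)
      = L2_inner f h - sine_coeff1 f * sine_coeff1 h"
      unfolding L2_inner_diff_scale_left[OF fh(1) sine_mode_L2 L2_unit_diff_scale[OF fh(2) sine_mode_L2]]
        L2_inner_diff_scale_right[OF fh(2) sine_mode_L2 fh(1)]
        L2_inner_diff_scale_right[OF fh(2) sine_mode_L2 sine_mode_L2]
        L2_inner_commute[of sine_mode h] sine_mode_normalized
      by (simp add: L2_inner_sine_mode)
  qed
  have cs: "(L2_inner k u - sine_coeff1 u * sine_coeff1 k)\<^sup>2
      \<le> (L2_inner k k - (sine_coeff1 k)\<^sup>2) * (L2_inner u u - (sine_coeff1 u)\<^sup>2)"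
    using L2_Cauchy_Schwarz[OF residual(1)[OF assms(4,4)] residual(1)[OF uL uL]]
    by (simp add: residual(2) assms(4) uL power2_eq_square mult.commute)
  have R: "L2_inner k k - (sine_coeff1 k)\<^sup>2 \<ge> 0"
    using L2_inner_self_nonneg[of "\<lambda>x. k x - sine_coeff1 k * sine_mode x"]
    by (simp add: residual(2) assms(4) power2_eq_square)
  show ?thesis
    unfolding L2_norm_power2
    by (rule rank_one_perturbation_inequality[OF spectral_gap_H10[OF assms(1-3)] cs R assms(6)
          assms(7)[unfolded L2_norm_power2]])
qed

end
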